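(* Let $G=L\wr P$ be a product type primitive group on $\Omega=\Gamma^k$, where $L\leqslant\mathrm{Sym}(\Gamma)$ and $P\leqslant S_k$. Then $r(G)=1$ if and only if $r(L)=D(P)$ and $t_{D(P)}=|P|/D(P)!$.
   Context: **Product type.** $G=L\wr P$ is a product type primitive group if $k\geqslant 2$, $P\leqslant S_k$ is transitive, $L\leqslant \mathrm{Sym}(\Gamma)$ is a finite primitive group that is either almost simple or of diagonal type (in the sense of the O'Nan–Scott theorem), and $G$ acts on $\Omega=\Gamma^k$ with its product action. **Notation.** For a transitive permutation group $X$, $r(X)$ is the number of regular suborbits of $X$, i.e. the number of regular orbits of a point stabiliser. A partition of $\{1,\dots,k\}$ into non-empty parts is a distinguishing partition for $P$ if the intersection of the setwise stabilisers in $P$ of its parts is trivial. $D(P)$ is the minimal number of parts in a distinguishing partition for $P$, and $t_m$ is the number of (unordered) distinguishing partitions for $P$ with exactly $m$ non-empty parts. *)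

theory Defs
  imports
    "HOL-Algebra.Group_Action" "HOL-Algebra.SimpleGroups" "HOL-Algebra.Product_Groups"
    "HOL-Algebra.Left_Coset" "HOL-Library.Disjoint_Sets" Complex_Main
begin

section \<open>Permutation groups\<close>

text \<open>
  A permutation group on \<open>E\<close> is a subgroup \<open>X\<close> of \<^term>\<open>BijGroup E\<close>, i.e. of the symmetric
  group on \<open>E\<close>. It acts on \<open>E\<close> through the identity map.
\<close>

abbreviation perm_group :: "'a set \<Rightarrow> ('a \<Rightarrow> 'a) set \<Rightarrow> ('a \<Rightarrow> 'a) monoid" where
  "perm_group E X \<equiv> BijGroup E\<lparr>carrier := X\<rparr>"

definition block :: "('g, 'c) monoid_scheme \<Rightarrow> 'a set \<Rightarrow> ('g \<Rightarrow> 'a \<Rightarrow> 'a) \<Rightarrow> 'a set \<Rightarrow> bool" where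
  "block G E \<phi> B \<longleftrightarrow>
     B \<subseteq> E \<and> B \<noteq> {} \<and> (\<forall>g \<in> carrier G. \<phi> g ` B = B \<or> \<phi> g ` B \<inter> B = {})"

definition primitive_action :: "('g, 'c) monoid_scheme \<Rightarrow> 'a set \<Rightarrow> ('g \<Rightarrow> 'a \<Rightarrow> 'a) \<Rightarrow> bool" where
  "primitive_action G E \<phi> \<longleftrightarrow>
     transitive_action G E \<phi> \<and> E \<noteq> {} \<and>
     (\<forall>B. block G E \<phi> B \<longrightarrow> B = E \<or> (\<exists>x. B = {x}))"

section \<open>Regular suborbits\<close>

text \<open>
  The action of \<open>G\<close> is meant to be faithful, so an orbit of a subgroup is regular iff all its
  points have trivial stabiliser.
\<close>

definition regular_orbits ::
    "('g, 'c) monoid_scheme \<Rightarrow> 'a set \<Rightarrow> ('g \<Rightarrow> 'a \<Rightarrow> 'a) \<Rightarrow> 'a set set" where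
  "regular_orbits H E \<phi> = {Q \<in> orbits H E \<phi>. \<forall>x \<in> Q. stabilizer H \<phi> x = {\<one>\<^bsub>H\<^esub>}}"

definition num_regular_suborbits ::
    "('g, 'c) monoid_scheme \<Rightarrow> 'a set \<Rightarrow> ('g \<Rightarrow> 'a \<Rightarrow> 'a) \<Rightarrow> nat" where
  "num_regular_suborbits G E \<phi> =
     (let x = (SOME x. x \<in> E)
      in card (regular_orbits (G\<lparr>carrier := stabilizer G \<phi> x\<rparr>) E \<phi>))"

text \<open>For a transitive action the choice of the point is immaterial.\<close>

lemma num_regular_suborbits_eq:
  assumes "transitive_action G E \<phi>" and "x \<in> E"
  shows "num_regular_suborbits G E \<phi> =
           card (regular_orbits (G\<lparr>carrier := stabilizer G \<phi> x\<rparr>) E \<phi>)"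
proof -
  interpret transitive_action G E \<phi> by fact
  interpret G: group G using group_hom group_hom.axioms(1) by auto
  define S where "S y = G\<lparr>carrier := stabilizer G \<phi> y\<rparr>" for y
  have inj_img: "inj_on ((`) (\<phi> g)) (Pow E)" if "g \<in> carrier G" for g
    using inj_prop[OF that] by (simp add: inj_on_image_Pow)
  have orbE: "Q \<subseteq> E" if "Q \<in> regular_orbits (S y) E \<phi>" for Q y
    using that element_image
    by (auto simp: regular_orbits_def orbits_def orbit_def S_def stabilizer_def)
  have conj: "g \<otimes>\<^bsub>G\<^esub> h \<otimes>\<^bsub>G\<^esub> inv\<^bsub>G\<^esub> g \<in> stabilizer G \<phi> (\<phi> g y)"
    if "g \<in> carrier G" "h \<in> stabilizer G \<phi> y" "y \<in> E" for g h y
  proof -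
    have h: "h \<in> carrier G" "\<phi> h y = y" using that by (auto simp: stabilizer_def)
    have gy: "\<phi> g y \<in> E" using that element_image by blast
    have "\<phi> (g \<otimes>\<^bsub>G\<^esub> h \<otimes>\<^bsub>G\<^esub> inv\<^bsub>G\<^esub> g) (\<phi> g y) = \<phi> (g \<otimes>\<^bsub>G\<^esub> h) (\<phi> (inv\<^bsub>G\<^esub> g) (\<phi> g y))"
      using that h gy by (intro composition_rule) auto
    also have "\<phi> (inv\<^bsub>G\<^esub> g) (\<phi> g y) = y"
      using orbit_sym_aux[OF that(1) that(3) refl] .
    also have "\<phi> (g \<otimes>\<^bsub>G\<^esub> h) y = \<phi> g y"
      using composition_rule[OF that(3) that(1) h(1)] h(2) by simp
    finally show ?thesis using that h by (auto simp: stabilizer_def)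
  qed
  have img: "\<phi> g ` Q \<in> regular_orbits (S (\<phi> g y)) E \<phi>"
    if g: "g \<in> carrier G" and y: "y \<in> E" and Q: "Q \<in> regular_orbits (S y) E \<phi>" for g y Q
  proof -
    obtain z where z: "z \<in> E" and Qz: "Q = orbit (S y) \<phi> z"
      and reg: "\<And>w. w \<in> Q \<Longrightarrow> stabilizer (S y) \<phi> w = {\<one>\<^bsub>G\<^esub>}"
      using Q by (auto simp: regular_orbits_def orbits_def S_def)
    have gy: "\<phi> g y \<in> E" and gz: "\<phi> g z \<in> E" using g y z element_image by blast+
    have comm: "\<phi> g (\<phi> h w) = \<phi> (g \<otimes>\<^bsub>G\<^esub> h \<otimes>\<^bsub>G\<^esub> inv\<^bsub>G\<^esub> g) (\<phi> g w)"
      if "h \<in> carrier G" "w \<in> E" for h w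
    proof -
      have gw: "\<phi> g w \<in> E" using g that element_image by blast
      have "\<phi> (g \<otimes>\<^bsub>G\<^esub> h \<otimes>\<^bsub>G\<^esub> inv\<^bsub>G\<^esub> g) (\<phi> g w) = \<phi> (g \<otimes>\<^bsub>G\<^esub> h) (\<phi> (inv\<^bsub>G\<^esub> g) (\<phi> g w))"
        using that g gw by (intro composition_rule) auto
      also have "\<phi> (inv\<^bsub>G\<^esub> g) (\<phi> g w) = w"
        using orbit_sym_aux[OF g that(2) refl] .
      also have "\<phi> (g \<otimes>\<^bsub>G\<^esub> h) w = \<phi> g (\<phi> h w)"
        using composition_rule[OF that(2) g that(1)] .
      finally show ?thesis by simp
    qed
    have conj_surj: "\<exists>h \<in> stabilizer G \<phi> y. u = g \<otimes>\<^bsub>G\<^esub> h \<otimes>\<^bsub>G\<^esub> inv\<^bsub>G\<^esub> g"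
      if u: "u \<in> stabilizer G \<phi> (\<phi> g y)" for u
    proof
      have uG: "u \<in> carrier G" using u by (auto simp: stabilizer_def)
      have "\<phi> (inv\<^bsub>G\<^esub> g) (\<phi> g y) = y" using orbit_sym_aux[OF g y refl] .
      then show "inv\<^bsub>G\<^esub> g \<otimes>\<^bsub>G\<^esub> u \<otimes>\<^bsub>G\<^esub> g \<in> stabilizer G \<phi> y"
        using conj[OF _ u gy, of "inv\<^bsub>G\<^esub> g"] g by simp
      show "u = g \<otimes>\<^bsub>G\<^esub> (inv\<^bsub>G\<^esub> g \<otimes>\<^bsub>G\<^esub> u \<otimes>\<^bsub>G\<^esub> g) \<otimes>\<^bsub>G\<^esub> inv\<^bsub>G\<^esub> g"
        using g uG by (simp add: G.m_assoc) (simp add: G.m_assoc[symmetric])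
    qed
    have "\<phi> g ` Q = orbit (S (\<phi> g y)) \<phi> (\<phi> g z)"
    proof (intro equalityI subsetI)
      fix v assume "v \<in> \<phi> g ` Q"
      then obtain h where h: "h \<in> stabilizer G \<phi> y" and v: "v = \<phi> g (\<phi> h z)"
        by (auto simp: Qz orbit_def S_def)
      then have "v = \<phi> (g \<otimes>\<^bsub>G\<^esub> h \<otimes>\<^bsub>G\<^esub> inv\<^bsub>G\<^esub> g) (\<phi> g z)"
        using comm[OF _ z] by (auto simp: stabilizer_def)
      with conj[OF g h y] show "v \<in> orbit (S (\<phi> g y)) \<phi> (\<phi> g z)"
        by (auto simp: orbit_def S_def)
    next
      fix v assume "v \<in> orbit (S (\<phi> g y)) \<phi> (\<phi> g z)"
      then obtain u where u: "u \<in> stabilizer G \<phi> (\<phi> g y)" and v: "v = \<phi> u (\<phi> g z)"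
        by (auto simp: orbit_def S_def)
      obtain h where h: "h \<in> stabilizer G \<phi> y" and "u = g \<otimes>\<^bsub>G\<^esub> h \<otimes>\<^bsub>G\<^esub> inv\<^bsub>G\<^esub> g"
        using conj_surj[OF u] by blast
      then have "v = \<phi> g (\<phi> h z)"
        using v comm[OF _ z] by (auto simp: stabilizer_def)
      with h show "v \<in> \<phi> g ` Q" by (auto simp: Qz orbit_def S_def)
    qed
    moreover have "stabilizer (S (\<phi> g y)) \<phi> v = {\<one>\<^bsub>G\<^esub>}" if vQ: "v \<in> \<phi> g ` Q" for v
    proof -
      obtain w where w: "w \<in> Q" and v: "v = \<phi> g w" using vQ by blast
      have wE: "w \<in> E" using w orbE[OF Q] by blast
      have "u = \<one>\<^bsub>G\<^esub>" if u: "u \<in> stabilizer (S (\<phi> g y)) \<phi> v" for u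
      proof -
        have u1: "u \<in> stabilizer G \<phi> (\<phi> g y)" and u2: "\<phi> u v = v"
          using u by (auto simp: stabilizer_def S_def)
        obtain h where h: "h \<in> stabilizer G \<phi> y" and uh: "u = g \<otimes>\<^bsub>G\<^esub> h \<otimes>\<^bsub>G\<^esub> inv\<^bsub>G\<^esub> g"
          using conj_surj[OF u1] by blast
        have hG: "h \<in> carrier G" using h by (auto simp: stabilizer_def)
        have "\<phi> g (\<phi> h w) = \<phi> g w" using comm[OF hG wE] uh u2 v by simp
        then have "\<phi> h w = w"
          using inj_prop[OF g] wE element_image[OF hG wE refl] by (auto dest: inj_onD)
        then have "h \<in> stabilizer (S y) \<phi> w" using h by (simp add: stabilizer_def S_def)
        then have "h = \<one>\<^bsub>G\<^esub>" using reg[OF w] by simp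
        then show ?thesis using uh g by simp
      qed
      moreover have "\<one>\<^bsub>G\<^esub> \<in> stabilizer (S (\<phi> g y)) \<phi> v"
        using stabilizer_one_closed[OF gy] stabilizer_one_closed[of v] v
          element_image[OF g wE refl]
        by (auto simp: stabilizer_def S_def)
      ultimately show ?thesis by blast
    qed
    ultimately show ?thesis
      using gz by (auto simp: regular_orbits_def orbits_def S_def)
  qed
  have eq: "card (regular_orbits (S y) E \<phi>) = card (regular_orbits (S y') E \<phi>)"
    if y: "y \<in> E" and y': "y' \<in> E" for y y'
  proof -
    obtain g where g: "g \<in> carrier G" and gy: "\<phi> g y = y'" using unique_orbit[OF y y'] by blast
    have gy': "\<phi> (inv\<^bsub>G\<^esub> g) y' = y" using orbit_sym_aux[OF g y gy] .
    have "bij_betw ((`) (\<phi> g)) (regular_orbits (S y) E \<phi>) (regular_orbits (S y') E \<phi>)"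
      unfolding bij_betw_def
    proof
      show "inj_on ((`) (\<phi> g)) (regular_orbits (S y) E \<phi>)"
        using inj_img[OF g] orbE by (meson PowI inj_on_subset subsetI)
      show "(`) (\<phi> g) ` regular_orbits (S y) E \<phi> = regular_orbits (S y') E \<phi>"
      proof (intro equalityI subsetI)
        fix Q assume "Q \<in> (`) (\<phi> g) ` regular_orbits (S y) E \<phi>"
        then show "Q \<in> regular_orbits (S y') E \<phi>" using img[OF g y] gy by auto
      next
        fix Q assume Q: "Q \<in> regular_orbits (S y') E \<phi>"
        have "\<phi> (inv\<^bsub>G\<^esub> g) ` Q \<in> regular_orbits (S y) E \<phi>"
          using img[OF _ y' Q, of "inv\<^bsub>G\<^esub> g"] g gy' by simp
        moreover have "\<phi> g (\<phi> (inv\<^bsub>G\<^esub> g) w) = w" if "w \<in> Q" for w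
          using orbit_sym_aux[of "inv\<^bsub>G\<^esub> g" w, OF _ _ refl] g that orbE[OF Q] by auto
        then have "\<phi> g ` \<phi> (inv\<^bsub>G\<^esub> g) ` Q = Q" by (force simp: image_image)
        ultimately show "Q \<in> (`) (\<phi> g) ` regular_orbits (S y) E \<phi>" by (metis imageI)
      qed
    qed
    then show ?thesis by (rule bij_betw_same_card)
  qed
  show ?thesis
    unfolding num_regular_suborbits_def Let_def
    using eq[OF someI[of "\<lambda>x. x \<in> E", OF assms(2)] assms(2)] by (simp add: S_def)
qed

section \<open>Almost simple groups and groups of diagonal type\<close>

text \<open>
  A \<^term>\<open>simple_group\<close> is finite by definition (it has \<^term>\<open>order G > 1\<close>), so up to
  isomorphism its carrier consists of natural numbers.
\<close>

definition nonabelian_simple :: "('a, 'c) monoid_scheme \<Rightarrow> bool" where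
  "nonabelian_simple T \<longleftrightarrow> simple_group T \<and> \<not> comm_group T"

definition inner_auto :: "('a, 'c) monoid_scheme \<Rightarrow> ('a \<Rightarrow> 'a) set" where
  "inner_auto T = {(\<lambda>x \<in> carrier T. g \<otimes>\<^bsub>T\<^esub> x \<otimes>\<^bsub>T\<^esub> inv\<^bsub>T\<^esub> g) | g. g \<in> carrier T}"

definition almost_simple :: "('a, 'c) monoid_scheme \<Rightarrow> bool" where
  "almost_simple G \<longleftrightarrow>
     (\<exists>(T :: nat monoid) A. nonabelian_simple T \<and> subgroup A (AutoGroup T) \<and>
        inner_auto T \<subseteq> A \<and> G \<cong> AutoGroup T\<lparr>carrier := A\<rparr>)"

abbreviation power_group :: "('a, 'c) monoid_scheme \<Rightarrow> nat \<Rightarrow> (nat \<Rightarrow> 'a) monoid" where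
  "power_group T m \<equiv> product_group {1..m} (\<lambda>_. T)"

definition diagonal_subgroup :: "('a, 'c) monoid_scheme \<Rightarrow> nat \<Rightarrow> (nat \<Rightarrow> 'a) set" where
  "diagonal_subgroup T m = {(\<lambda>i \<in> {1..m}. t) | t. t \<in> carrier T}"

definition diagonal_cosets :: "('a, 'c) monoid_scheme \<Rightarrow> nat \<Rightarrow> (nat \<Rightarrow> 'a) set set" where
  "diagonal_cosets T m = lcosets\<^bsub>power_group T m\<^esub> (diagonal_subgroup T m)"

text \<open>The group \<open>T\<^sup>m\<close>, viewed as a permutation group on the cosets of its diagonal subgroup.\<close>

definition diagonal_base ::
    "('a, 'c) monoid_scheme \<Rightarrow> nat \<Rightarrow> ((nat \<Rightarrow> 'a) set \<Rightarrow> (nat \<Rightarrow> 'a) set) set" where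
  "diagonal_base T m =
     (\<lambda>g. \<lambda>C \<in> diagonal_cosets T m. g <#\<^bsub>power_group T m\<^esub> C) ` carrier (power_group T m)"

text \<open>
  \<open>L \<le> Sym(\<Gamma>)\<close> is of diagonal type if, after identifying \<open>\<Gamma>\<close> with the cosets of the diagonal
  subgroup of some \<open>T\<^sup>m\<close> by a bijection \<open>f\<close>, it lies between \<open>T\<^sup>m\<close> and the normaliser of \<open>T\<^sup>m\<close> in
  the symmetric group. Primitivity of \<open>L\<close> is not part of this definition.
\<close>

definition diagonal_type :: "'a set \<Rightarrow> ('a \<Rightarrow> 'a) set \<Rightarrow> bool" where
  "diagonal_type \<Gamma> L \<longleftrightarrow>
     (\<exists>(T :: nat monoid) m f X. nonabelian_simple T \<and> m \<ge> 2 \<and>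
        bij_betw f \<Gamma> (diagonal_cosets T m) \<and>
        X = (\<lambda>g. \<lambda>C \<in> diagonal_cosets T m. f (g (inv_into \<Gamma> f C))) ` L \<and>
        diagonal_base T m \<subseteq> X \<and>
        X \<subseteq> normalizer (BijGroup (diagonal_cosets T m)) (diagonal_base T m))"

section \<open>Wreath products and the product action\<close>

definition wreath_product ::
    "('a, 'c) monoid_scheme \<Rightarrow> 'i set \<Rightarrow> ('i \<Rightarrow> 'i) set \<Rightarrow> (('i \<Rightarrow> 'a) \<times> ('i \<Rightarrow> 'i)) monoid" where
  "wreath_product L I P =
     \<lparr>carrier = (I \<rightarrow>\<^sub>E carrier L) \<times> P,
      monoid.mult = (\<lambda>(a, p) (b, q).
        (\<lambda>i \<in> I. a i \<otimes>\<^bsub>L\<^esub> b (inv_into I p i), p \<otimes>\<^bsub>BijGroup I\<^esub> q)),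
      one = (\<lambda>i \<in> I. \<one>\<^bsub>L\<^esub>, \<one>\<^bsub>BijGroup I\<^esub>)\<rparr>"

lemma inv_into_BijGroup_mult:
  assumes "p \<in> Bij I" "q \<in> Bij I" "i \<in> I"
  shows "inv_into I (p \<otimes>\<^bsub>BijGroup I\<^esub> q) i = inv_into I q (inv_into I p i)"
proof -
  have bij: "bij_betw p I I" "bij_betw q I I" using assms by (auto simp: Bij_def)
  define j where "j = inv_into I q (inv_into I p i)"
  have pi: "inv_into I p i \<in> I" using bij(1) assms(3) by (simp add: bij_betw_def inv_into_into)
  have j: "j \<in> I" unfolding j_def using bij(2) pi by (simp add: bij_betw_def inv_into_into)
  have "compose I p q j = i"
    using j bij pi assms(3) by (simp add: compose_eq j_def bij_betw_inv_into_right)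
  moreover have "inj_on (compose I p q) I"
    using compose_Bij[OF assms(1,2)] by (auto simp: Bij_def bij_betw_def)
  ultimately show ?thesis
    using j assms(1,2) by (simp add: BijGroup_def j_def inv_into_f_eq)
qed

lemma group_wreath_product:
  assumes L: "group L" and P: "subgroup P (BijGroup I)"
  shows "group (wreath_product L I P)"
proof -
  interpret L: group L by fact
  interpret B: group "BijGroup I" by (rule group_BijGroup)
  interpret P: subgroup P "BijGroup I" by fact
  have PB: "p \<in> Bij I" if "p \<in> P" for p using P.subset that by (auto simp: BijGroup_def)
  have bij: "bij_betw p I I" if "p \<in> P" for p using PB[OF that] by (simp add: Bij_def)
  have invI: "inv_into I p i \<in> I" if "p \<in> P" "i \<in> I" for p i
    using PB[OF that(1)] that(2) by (rule Bij_inv_into_mem)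
  have inv1: "inv_into I \<one>\<^bsub>BijGroup I\<^esub> i = i" if "i \<in> I" for i
    using that by (intro inv_into_f_eq) (auto simp: BijGroup_def inj_on_def)
  show ?thesis
  proof (rule groupI)
    fix x y assume "x \<in> carrier (wreath_product L I P)" "y \<in> carrier (wreath_product L I P)"
    then show "x \<otimes>\<^bsub>wreath_product L I P\<^esub> y \<in> carrier (wreath_product L I P)"
      using invI by (auto simp: wreath_product_def PiE_iff)
  next
    show "\<one>\<^bsub>wreath_product L I P\<^esub> \<in> carrier (wreath_product L I P)"
      by (auto simp: wreath_product_def)
  next
    fix x y z
    assume "x \<in> carrier (wreath_product L I P)" "y \<in> carrier (wreath_product L I P)"
      "z \<in> carrier (wreath_product L I P)"
    then show "x \<otimes>\<^bsub>wreath_product L I P\<^esub> y \<otimes>\<^bsub>wreath_product L I P\<^esub> z =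
               x \<otimes>\<^bsub>wreath_product L I P\<^esub> (y \<otimes>\<^bsub>wreath_product L I P\<^esub> z)"
      using invI
      by (auto simp: wreath_product_def PiE_iff inv_into_BijGroup_mult PB L.m_assoc B.m_assoc
          intro!: restrict_ext)
  next
    fix x assume "x \<in> carrier (wreath_product L I P)"
    then show "\<one>\<^bsub>wreath_product L I P\<^esub> \<otimes>\<^bsub>wreath_product L I P\<^esub> x = x"
      by (auto simp: wreath_product_def PiE_iff inv1 extensional_def restrict_def fun_eq_iff)
  next
    fix x assume x: "x \<in> carrier (wreath_product L I P)"
    obtain a p where xe: "x = (a, p)" and a: "a \<in> I \<rightarrow>\<^sub>E carrier L" and p: "p \<in> P"
      using x by (auto simp: wreath_product_def)
    let ?y = "(\<lambda>i \<in> I. inv\<^bsub>L\<^esub> a (p i), inv\<^bsub>BijGroup I\<^esub> p)"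
    have pI: "p i \<in> I" if "i \<in> I" for i using bij[OF p] that by (auto simp: bij_betw_def)
    have eq: "inv_into I (inv\<^bsub>BijGroup I\<^esub> p) i = p i" if "i \<in> I" for i
    proof (rule inv_into_f_eq)
      show "inj_on (inv\<^bsub>BijGroup I\<^esub> p) I"
        using bij[OF P.m_inv_closed[OF p]] by (simp add: bij_betw_def)
      show "p i \<in> I" using pI that .
      show "(inv\<^bsub>BijGroup I\<^esub> p) (p i) = i"
        using pI[OF that] bij[OF p] that
        by (simp add: inv_BijGroup PB p bij_betw_inv_into_left)
    qed
    have "?y \<in> carrier (wreath_product L I P)"
      using a p pI by (auto simp: wreath_product_def PiE_iff)
    moreover have "?y \<otimes>\<^bsub>wreath_product L I P\<^esub> x = \<one>\<^bsub>wreath_product L I P\<^esub>"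
      using a p pI
      by (auto simp: wreath_product_def xe PiE_iff eq intro!: restrict_ext)
    ultimately show "\<exists>y \<in> carrier (wreath_product L I P).
        y \<otimes>\<^bsub>wreath_product L I P\<^esub> x = \<one>\<^bsub>wreath_product L I P\<^esub>" by blast
  qed
qed

definition product_action ::
    "'a set \<Rightarrow> 'i set \<Rightarrow> ('i \<Rightarrow> ('a \<Rightarrow> 'a)) \<times> ('i \<Rightarrow> 'i) \<Rightarrow> ('i \<Rightarrow> 'a) \<Rightarrow> ('i \<Rightarrow> 'a)" where
  "product_action \<Gamma> I = (\<lambda>(a, p). \<lambda>w \<in> I \<rightarrow>\<^sub>E \<Gamma>. \<lambda>i \<in> I. a i (w (inv_into I p i)))"

lemma group_action_product_action:
  assumes L: "subgroup L (BijGroup \<Gamma>)" and P: "subgroup P (BijGroup I)"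
  shows "group_action (wreath_product (perm_group \<Gamma> L) I P) (I \<rightarrow>\<^sub>E \<Gamma>) (product_action \<Gamma> I)"
proof -
  let ?W = "wreath_product (perm_group \<Gamma> L) I P"
  let ?E = "I \<rightarrow>\<^sub>E \<Gamma>"
  interpret W: group ?W
    using L P group_BijGroup by (intro group_wreath_product group.subgroup_imp_group)
  have LB: "l \<in> Bij \<Gamma>" if "l \<in> L" for l
    using subgroup.subset[OF L] that by (auto simp: BijGroup_def)
  have PB: "p \<in> Bij I" if "p \<in> P" for p
    using subgroup.subset[OF P] that by (auto simp: BijGroup_def)
  have LG: "l c \<in> \<Gamma>" if "l \<in> L" "c \<in> \<Gamma>" for l c
    using Bij_imp_funcset[OF LB[OF that(1)]] that(2) by blast
  have invI: "inv_into I p i \<in> I" if "p \<in> P" "i \<in> I" for p i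
    using PB[OF that(1)] that(2) by (rule Bij_inv_into_mem)
  have closed: "product_action \<Gamma> I x w \<in> ?E" if "x \<in> carrier ?W" "w \<in> ?E" for x w
    using that invI LG by (auto simp: product_action_def wreath_product_def PiE_iff)
  have mult: "product_action \<Gamma> I (x \<otimes>\<^bsub>?W\<^esub> y) w = product_action \<Gamma> I x (product_action \<Gamma> I y w)"
    if xy: "x \<in> carrier ?W" "y \<in> carrier ?W" and w: "w \<in> ?E" for x y w
  proof -
    have "product_action \<Gamma> I y w \<in> ?E" using closed[OF xy(2) w] .
    then show ?thesis
      using xy w invI
      by (auto simp: product_action_def wreath_product_def PiE_iff inv_into_BijGroup_mult PB
          BijGroup_def[of \<Gamma>] LB compose_eq intro!: restrict_ext)
  qed
  have one: "product_action \<Gamma> I \<one>\<^bsub>?W\<^esub> w = w" if "w \<in> ?E" for w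
  proof -
    have "inv_into I \<one>\<^bsub>BijGroup I\<^esub> i = i" if "i \<in> I" for i
      using that by (intro inv_into_f_eq) (auto simp: BijGroup_def inj_on_def)
    with that show ?thesis
      by (auto simp: product_action_def wreath_product_def BijGroup_def[of \<Gamma>] PiE_iff
          extensional_def fun_eq_iff)
  qed
  have bij: "product_action \<Gamma> I x \<in> Bij ?E" if x: "x \<in> carrier ?W" for x
  proof -
    have "bij_betw (product_action \<Gamma> I x) ?E ?E"
    proof (rule bij_betw_byWitness[where f' = "product_action \<Gamma> I (inv\<^bsub>?W\<^esub> x)"])
      show "\<forall>w \<in> ?E. product_action \<Gamma> I (inv\<^bsub>?W\<^esub> x) (product_action \<Gamma> I x w) = w"
        using mult[OF W.inv_closed[OF x] x] one x by (metis W.l_inv)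
      show "\<forall>w \<in> ?E. product_action \<Gamma> I x (product_action \<Gamma> I (inv\<^bsub>?W\<^esub> x) w) = w"
        using mult[OF x W.inv_closed[OF x]] one x by (metis W.r_inv)
    qed (use closed x W.inv_closed in blast)+
    moreover have "product_action \<Gamma> I x \<in> extensional ?E"
      by (cases x) (simp add: product_action_def)
    ultimately show ?thesis by (simp add: Bij_def)
  qed
  show ?thesis
  proof (intro group_action.intro group_hom.intro group_hom_axioms.intro)
    show "group ?W" ..
    show "group (BijGroup ?E)" by (rule group_BijGroup)
    show "product_action \<Gamma> I \<in> hom ?W (BijGroup ?E)"
    proof (rule homI)
      fix x assume "x \<in> carrier ?W"
      then show "product_action \<Gamma> I x \<in> carrier (BijGroup ?E)"
        using bij by (simp add: BijGroup_def)
    next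
      fix x y assume xy: "x \<in> carrier ?W" "y \<in> carrier ?W"
      have "product_action \<Gamma> I (x \<otimes>\<^bsub>?W\<^esub> y) w =
            compose ?E (product_action \<Gamma> I x) (product_action \<Gamma> I y) w" for w
      proof (cases "w \<in> ?E")
        case True
        then show ?thesis using mult[OF xy True] by (simp add: compose_eq)
      next
        case False
        then show ?thesis
          using bij[OF W.m_closed[OF xy]]
          by (simp add: Bij_def extensional_def compose_def restrict_def)
      qed
      then show "product_action \<Gamma> I (x \<otimes>\<^bsub>?W\<^esub> y) =
            product_action \<Gamma> I x \<otimes>\<^bsub>BijGroup ?E\<^esub> product_action \<Gamma> I y"
        using bij xy by (auto simp: BijGroup_def)
    qed
  qed
qed

section \<open>Distinguishing partitions\<close>

definition distinguishing_partition :: "'i set \<Rightarrow> ('i \<Rightarrow> 'i) set \<Rightarrow> 'i set set \<Rightarrow> bool" where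
  "distinguishing_partition I P \<pi> \<longleftrightarrow>
     partition_on I \<pi> \<and> {p \<in> P. \<forall>A \<in> \<pi>. p ` A = A} = {\<one>\<^bsub>BijGroup I\<^esub>}"

definition distinguishing_number :: "'i set \<Rightarrow> ('i \<Rightarrow> 'i) set \<Rightarrow> nat" where
  "distinguishing_number I P = (LEAST m. \<exists>\<pi>. distinguishing_partition I P \<pi> \<and> card \<pi> = m)"

definition num_distinguishing_partitions :: "'i set \<Rightarrow> ('i \<Rightarrow> 'i) set \<Rightarrow> nat \<Rightarrow> nat" where
  "num_distinguishing_partitions I P m = card {\<pi>. distinguishing_partition I P \<pi> \<and> card \<pi> = m}"

end

(*
  Let H be a point stabiliser of L and R its set of regular orbits, so r(L) = card R. The
  stabiliser of a constant tuple is the wreath product of H by P, and a tuple w lies in a regular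
  orbit of it iff every w_i lies in a member of R and the colouring sending i to the H-orbit of w_i
  is fixed by no non-trivial element of P. Counting such tuples in two ways gives
  r(G) |P| = |C|, where C is the set of these distinguishing colourings with colours in R.
  If r(L) < D(P), then C is empty. If r(L) > D(P), then |C| > |P|, as C contains colourings with
  different images of size D(P). If r(L) = D(P), then every colouring in C is onto R, and
  |C| = D(P)! t_{D(P)}, one factor for naming the parts of the partition into colour classes.
*)

theory Submission
  imports Defs "HOL-Combinatorics.Permutations"
begin

section \<open>Counting points with trivial stabiliser\<close>

context group_action
begin

lemma orbit_subset: "x \<in> E \<Longrightarrow> orbit G \<phi> x \<subseteq> E"
  using element_image by (auto simp: orbit_def)

lemma orbit_eqI:
  assumes "x \<in> E" "y \<in> orbit G \<phi> x"
  shows "orbit G \<phi> y = orbit G \<phi> x"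
proof -
  have "y \<in> E" using assms orbit_subset by blast
  then have "orbit G \<phi> x \<in> orbits G E \<phi>" "orbit G \<phi> y \<in> orbits G E \<phi>"
    "y \<in> orbit G \<phi> y"
    using assms(1) orbit_refl by (auto simp: orbits_def)
  with disjoint_union assms(2) show ?thesis by blast
qed

lemma regular_orbitD:
  assumes "Q \<in> regular_orbits G E \<phi>" "x \<in> Q"
  shows "x \<in> E" "orbit G \<phi> x = Q" "stabilizer G \<phi> x = {\<one>}"
proof -
  obtain y where y: "y \<in> E" "Q = orbit G \<phi> y"
    using assms by (auto simp: regular_orbits_def orbits_def)
  show "x \<in> E" using orbit_subset y assms by blast
  show "orbit G \<phi> x = Q" using orbit_eqI y assms by blast
  show "stabilizer G \<phi> x = {\<one>}" using assms by (auto simp: regular_orbits_def)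
qed

text \<open>Conjugation by an element taking x to y turns the stabiliser of y into that of x. So one
  point with trivial stabiliser makes its whole orbit regular, although
  \<open>regular_orbits\<close> tests every point.\<close>

lemma stabilizer_orbit_trivial:
  assumes x: "x \<in> E" "stabilizer G \<phi> x = {\<one>}" and y: "y \<in> orbit G \<phi> x"
  shows "stabilizer G \<phi> y = {\<one>}"
proof -
  interpret G: group G using group_hom group_hom.axioms(1) by auto
  have yE: "y \<in> E" using orbit_subset x y by blast
  obtain g where g: "g \<in> carrier G" "\<phi> g x = y" using y by (auto simp: orbit_def)
  have gy: "\<phi> (inv g) y = x" using orbit_sym_aux g x by blast
  have "h = \<one>" if "h \<in> stabilizer G \<phi> y" for h
  proof -
    have h: "h \<in> carrier G" "\<phi> h y = y" using that by (auto simp: stabilizer_def)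
    have "\<phi> (inv g \<otimes> h \<otimes> g) x = x"
      using g h x yE gy by (simp add: composition_rule)
    then have "inv g \<otimes> h \<otimes> g \<in> stabilizer G \<phi> x" using g h by (simp add: stabilizer_def)
    then have "inv g \<otimes> h \<otimes> g = \<one>" using x by simp
    then have "g \<otimes> (inv g \<otimes> h \<otimes> g) \<otimes> inv g = \<one>" using g by simp
    then show ?thesis using G.conjugation_is_surj g h by simp
  qed
  then show ?thesis using stabilizer_one_closed[OF yE] by blast
qed

lemma orbit_in_regular_orbits:
  assumes "x \<in> E" "stabilizer G \<phi> x = {\<one>}"
  shows "orbit G \<phi> x \<in> regular_orbits G E \<phi>"
  using assms stabilizer_orbit_trivial by (auto simp: regular_orbits_def orbits_def)

lemma card_regular_orbit:
  assumes "Q \<in> regular_orbits G E \<phi>"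
  shows "card Q = order G"
proof -
  obtain y where y: "y \<in> E" "Q = orbit G \<phi> y"
    using assms by (auto simp: regular_orbits_def orbits_def)
  then have "stabilizer G \<phi> y = {\<one>}" using regular_orbitD[OF assms] orbit_refl by blast
  then show ?thesis using orbit_stabilizer_theorem y by fastforce
qed

lemma finite_regular_orbits:
  assumes "finite E"
  shows "finite (regular_orbits G E \<phi>)"
proof (rule finite_subset)
  show "regular_orbits G E \<phi> \<subseteq> Pow E" using regular_orbitD(1) by blast
  show "finite (Pow E)" using assms by simp
qed

text \<open>These points fill exactly the regular orbits, which are pairwise disjoint and of size
  \<open>order G\<close> by the orbit-stabiliser theorem. This turns counting regular orbits into
  counting points.\<close>

lemma card_trivial_stabilizer:
  assumes "finite E"
  shows "card {x \<in> E. stabilizer G \<phi> x = {\<one>}} = order G * card (regular_orbits G E \<phi>)"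
proof -
  have un: "{x \<in> E. stabilizer G \<phi> x = {\<one>}} = \<Union> (regular_orbits G E \<phi>)"
  proof (intro equalityI subsetI)
    fix x assume "x \<in> {x \<in> E. stabilizer G \<phi> x = {\<one>}}"
    then show "x \<in> \<Union> (regular_orbits G E \<phi>)"
      using orbit_in_regular_orbits[of x] orbit_refl[of x] by blast
  next
    fix x assume "x \<in> \<Union> (regular_orbits G E \<phi>)"
    then obtain Q where "Q \<in> regular_orbits G E \<phi>" "x \<in> Q" by blast
    from regular_orbitD[OF this] show "x \<in> {x \<in> E. stabilizer G \<phi> x = {\<one>}}" by simp
  qed
  have "order G * card (regular_orbits G E \<phi>) = card (\<Union> (regular_orbits G E \<phi>))"
  proof (rule card_partition)
    show "finite (regular_orbits G E \<phi>)" using finite_regular_orbits assms .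
    show "finite (\<Union> (regular_orbits G E \<phi>))" using assms by (simp flip: un)
    show "Q1 \<inter> Q2 = {}"
      if "Q1 \<in> regular_orbits G E \<phi>" "Q2 \<in> regular_orbits G E \<phi>" "Q1 \<noteq> Q2" for Q1 Q2
      using that regular_orbitD(2) by blast
  qed (rule card_regular_orbit)
  then show ?thesis by (simp add: un)
qed

end

section \<open>Distinguishing colourings\<close>

text \<open>Functional counterpart of \<open>distinguishing_partition\<close>: stabilising every
  colour class amounts to preserving the colour of every point. Colourings are the natural form here
  because a tuple colours its coordinates by the orbits of its entries.\<close>

definition distinguishing :: "'i set \<Rightarrow> ('i \<Rightarrow> 'i) set \<Rightarrow> ('i \<Rightarrow> 'c) \<Rightarrow> bool" where
  "distinguishing I P c \<longleftrightarrow> {p \<in> P. \<forall>i \<in> I. c (p i) = c i} = {\<one>\<^bsub>BijGroup I\<^esub>}"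

lemma distinguishingI:
  assumes "\<one>\<^bsub>BijGroup I\<^esub> \<in> P"
    and "\<And>p. p \<in> P \<Longrightarrow> \<forall>i \<in> I. c (p i) = c i \<Longrightarrow> p = \<one>\<^bsub>BijGroup I\<^esub>"
  shows "distinguishing I P c"
proof -
  have "\<forall>i \<in> I. c (\<one>\<^bsub>BijGroup I\<^esub> i) = c i" by (simp add: BijGroup_def)
  with assms show ?thesis unfolding distinguishing_def by blast
qed

lemma distinguishingD:
  assumes "distinguishing I P c" "p \<in> P" "\<forall>i \<in> I. c (p i) = c i"
  shows "p = \<one>\<^bsub>BijGroup I\<^esub>"
  using assms unfolding distinguishing_def by blast

text \<open>Only values on I enter, since elements of P map I to itself. This allows passing between
  a colouring and its restriction to I.\<close>

lemma distinguishing_cong: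
  assumes "P \<subseteq> Bij I" "\<And>i. i \<in> I \<Longrightarrow> c i = d i"
  shows "distinguishing I P c \<longleftrightarrow> distinguishing I P d"
proof -
  have "p i \<in> I" if "p \<in> P" "i \<in> I" for p i
    using assms(1) that Bij_imp_funcset by fastforce
  then have "{p \<in> P. \<forall>i \<in> I. c (p i) = c i} = {p \<in> P. \<forall>i \<in> I. d (p i) = d i}"
    using assms(2) by auto
  then show ?thesis by (simp add: distinguishing_def)
qed

section \<open>Colourings and their partitions into colour classes\<close>

text \<open>Indexed by points instead of colours, so that colours which do not occur contribute no
  empty part.\<close>

definition colour_classes :: "'i set \<Rightarrow> ('i \<Rightarrow> 'c) \<Rightarrow> 'i set set" where
  "colour_classes I c = (\<lambda>i. {j \<in> I. c j = c i}) ` I"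

lemma partition_on_colour_classes: "partition_on I (colour_classes I c)"
  by (rule partition_onI) (auto simp: colour_classes_def disjnt_def)

lemma card_colour_classes: "card (colour_classes I c) = card (c ` I)"
proof -
  have "colour_classes I c = (\<lambda>x. {j \<in> I. c j = x}) ` c ` I"
    by (auto simp: colour_classes_def)
  moreover have "inj_on (\<lambda>x. {j \<in> I. c j = x}) (c ` I)" by (auto simp: inj_on_def)
  ultimately show ?thesis by (simp add: card_image)
qed

text \<open>A partition is determined by its equivalence relation, which for colour classes is
  having the same colour.\<close>

lemma colour_classes_eq_iff:
  "colour_classes I c = colour_classes I d \<longleftrightarrow> (\<forall>i \<in> I. \<forall>j \<in> I. c i = c j \<longleftrightarrow> d i = d j)"
proof
  assume eq: "colour_classes I c = colour_classes I d"
  have "{j \<in> I. c j = c i} = {j \<in> I. d j = d i}" if i: "i \<in> I" for i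
  proof -
    have "{j \<in> I. c j = c i} \<in> colour_classes I c" using i by (auto simp: colour_classes_def)
    then have "{j \<in> I. c j = c i} \<in> colour_classes I d" by (simp add: eq)
    then obtain k where k: "k \<in> I" "{j \<in> I. c j = c i} = {j \<in> I. d j = d k}"
      by (auto simp: colour_classes_def)
    then have "d i = d k" using i by blast
    with k show ?thesis by simp
  qed
  then show "\<forall>i \<in> I. \<forall>j \<in> I. c i = c j \<longleftrightarrow> d i = d j" by blast
next
  assume "\<forall>i \<in> I. \<forall>j \<in> I. c i = c j \<longleftrightarrow> d i = d j"
  then show "colour_classes I c = colour_classes I d"
    unfolding colour_classes_def by (intro image_cong) auto
qed

text \<open>If p preserves colours, it maps each class into itself. It maps onto the class because p
  is onto I and the preimage of a point has the colour of that point.\<close>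

lemma stabilises_colour_classes_iff:
  assumes "p \<in> Bij I"
  shows "(\<forall>A \<in> colour_classes I c. p ` A = A) \<longleftrightarrow> (\<forall>i \<in> I. c (p i) = c i)"
proof
  assume "\<forall>A \<in> colour_classes I c. p ` A = A"
  then show "\<forall>i \<in> I. c (p i) = c i" by (auto simp: colour_classes_def)
next
  assume c: "\<forall>i \<in> I. c (p i) = c i"
  have "p ` I = I" using assms by (auto simp: Bij_def bij_betw_def)
  then show "\<forall>A \<in> colour_classes I c. p ` A = A"
    using c by (auto simp: colour_classes_def image_iff) (metis imageE)
qed

lemma distinguishing_partition_colour_classes:
  assumes "P \<subseteq> Bij I"
  shows "distinguishing_partition I P (colour_classes I c) \<longleftrightarrow> distinguishing I P c"
proof -
  have "{p \<in> P. \<forall>A \<in> colour_classes I c. p ` A = A} = {p \<in> P. \<forall>i \<in> I. c (p i) = c i}"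
  proof (intro Collect_cong conj_cong refl)
    fix p assume "p \<in> P"
    then have "p \<in> Bij I" using assms by blast
    then show "(\<forall>A \<in> colour_classes I c. p ` A = A) \<longleftrightarrow> (\<forall>i \<in> I. c (p i) = c i)"
      by (rule stabilises_colour_classes_iff)
  qed
  then show ?thesis
    by (simp add: distinguishing_partition_def distinguishing_def partition_on_colour_classes)
qed

text \<open>Each point is coloured by the label f A of the part A containing it; injectivity of f
  keeps different parts apart. With f taking values in a given palette, partitions become colourings
  by that palette.\<close>

lemma obtain_colouring:
  assumes part: "partition_on I \<pi>" and f: "inj_on f \<pi>"
  obtains c where "c \<in> I \<rightarrow>\<^sub>E f ` \<pi>" "colour_classes I c = \<pi>" "c ` I = f ` \<pi>"
proof -
  have "\<forall>i \<in> I. \<exists>A. A \<in> \<pi> \<and> i \<in> A" using part by (auto simp: partition_on_def)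
  then obtain q where q: "\<And>i. i \<in> I \<Longrightarrow> q i \<in> \<pi> \<and> i \<in> q i" by metis
  have q_eq: "q i = A" if "A \<in> \<pi>" "i \<in> A" for i A
  proof -
    have "i \<in> I" using part that by (auto simp: partition_on_def)
    with q[of i] that part show ?thesis
      by (auto simp: partition_on_def disjoint_def)
  qed
  define c where "c = (\<lambda>i \<in> I. f (q i))"
  have sub: "A \<subseteq> I" "A \<noteq> {}" if "A \<in> \<pi>" for A using part that by (auto simp: partition_on_def)
  have cls: "{j \<in> I. c j = c i} = q i" if i: "i \<in> I" for i
  proof -
    have "{j \<in> I. c j = c i} = {j \<in> I. q j = q i}"
      using i q f by (auto simp: c_def inj_on_eq_iff)
    also have "\<dots> = q i" using i q q_eq sub(1)[of "q i"] by blast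
    finally show ?thesis .
  qed
  have qI: "q ` I = \<pi>"
  proof
    show "\<pi> \<subseteq> q ` I"
    proof
      fix A assume "A \<in> \<pi>"
      then obtain i where "i \<in> A" "i \<in> I" using sub by blast
      with q_eq \<open>A \<in> \<pi>\<close> show "A \<in> q ` I" by blast
    qed
  qed (use q in auto)
  show ?thesis
  proof
    show "c \<in> I \<rightarrow>\<^sub>E f ` \<pi>" using q by (auto simp: c_def)
    show "colour_classes I c = \<pi>" using cls qI by (simp add: colour_classes_def)
    show "c ` I = f ` \<pi>" by (simp add: c_def image_image flip: qI)
  qed
qed

section \<open>The distinguishing number\<close>

text \<open>The partition into singletons, i.e. the classes of the identity colouring, is
  distinguishing. Hence the \<open>LEAST\<close> in the definition of D(P) ranges over a non-empty
  set and is attained.\<close>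

lemma distinguishing_number_exists:
  assumes P: "P \<subseteq> Bij I" "\<one>\<^bsub>BijGroup I\<^esub> \<in> P"
  shows "\<exists>\<pi>. distinguishing_partition I P \<pi> \<and> card \<pi> = distinguishing_number I P"
proof -
  have "distinguishing I P (\<lambda>i. i)"
    using P by (auto simp: distinguishing_def BijGroup_def Bij_def extensional_def fun_eq_iff)
  then have "distinguishing_partition I P (colour_classes I (\<lambda>i. i))"
    using distinguishing_partition_colour_classes P by blast
  then have "\<exists>m \<pi>. distinguishing_partition I P \<pi> \<and> card \<pi> = m" by blast
  then show ?thesis unfolding distinguishing_number_def by (rule LeastI_ex)
qed

text \<open>The colour classes form a distinguishing partition with one part for each colour
  used.\<close>

lemma distinguishing_number_le:
  assumes "P \<subseteq> Bij I" "distinguishing I P c"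
  shows "distinguishing_number I P \<le> card (c ` I)"
  unfolding distinguishing_number_def
  using distinguishing_partition_colour_classes[OF assms(1), of c] assms(2)
    card_colour_classes[of I c]
  by (intro Least_le) blast

lemma distinguishing_number_pos:
  assumes "P \<subseteq> Bij I" "\<one>\<^bsub>BijGroup I\<^esub> \<in> P" "finite I" "I \<noteq> {}"
  shows "distinguishing_number I P > 0"
proof -
  obtain \<pi> where \<pi>: "distinguishing_partition I P \<pi>" "card \<pi> = distinguishing_number I P"
    using distinguishing_number_exists assms by blast
  have "finite \<pi>" "\<pi> \<noteq> {}"
    using \<pi>(1) assms finite_elements[of I \<pi>]
    by (auto simp: distinguishing_partition_def partition_on_def)
  with \<pi> show ?thesis by (metis card_gt_0_iff)
qed

section \<open>The action of P on distinguishing colourings\<close>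

text \<open>If p preserves the colouring c after q, then the conjugate of p by q, called
  \<open>?r\<close> below, preserves c itself and is therefore trivial.\<close>

lemma distinguishing_compose:
  assumes P: "subgroup P (BijGroup I)" and c: "distinguishing I P c" and q: "q \<in> P"
  shows "distinguishing I P (\<lambda>i. c (q i))"
proof -
  interpret B: group "BijGroup I" by (rule group_BijGroup)
  interpret P: subgroup P "BijGroup I" by fact
  have PB: "P \<subseteq> Bij I" using P.subset by (simp add: BijGroup_def)
  have app: "(x \<otimes>\<^bsub>BijGroup I\<^esub> y) i = x (y i)" if "x \<in> P" "y \<in> P" "i \<in> I" for x y i
    using that PB by (simp add: BijGroup_def compose_eq subset_iff)
  have memI: "x i \<in> I" if "x \<in> P" "i \<in> I" for x i
    using that PB Bij_imp_funcset by fastforce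
  have "p = \<one>\<^bsub>BijGroup I\<^esub>" if p: "p \<in> P" "\<forall>i \<in> I. c (q (p i)) = c (q i)" for p
  proof -
    let ?r = "q \<otimes>\<^bsub>BijGroup I\<^esub> p \<otimes>\<^bsub>BijGroup I\<^esub> inv\<^bsub>BijGroup I\<^esub> q"
    have qi: "q ((inv\<^bsub>BijGroup I\<^esub> q) i) = i" if "i \<in> I" for i
    proof -
      have "(q \<otimes>\<^bsub>BijGroup I\<^esub> inv\<^bsub>BijGroup I\<^esub> q) i = i"
        using that q P.subset by (simp add: subset_iff) (simp add: BijGroup_def)
      moreover have "(q \<otimes>\<^bsub>BijGroup I\<^esub> inv\<^bsub>BijGroup I\<^esub> q) i = q ((inv\<^bsub>BijGroup I\<^esub> q) i)"
        using q that by (intro app) auto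
      ultimately show ?thesis by metis
    qed
    have "\<forall>i \<in> I. c (?r i) = c i"
      using p q app memI qi by simp
    then have "?r = \<one>\<^bsub>BijGroup I\<^esub>" using distinguishingD[OF c] p q by simp
    moreover have "p = inv\<^bsub>BijGroup I\<^esub> q \<otimes>\<^bsub>BijGroup I\<^esub> ?r \<otimes>\<^bsub>BijGroup I\<^esub> q"
      using p(1) q P.subset by (simp add: B.m_assoc subset_iff) (simp add: B.m_assoc[symmetric])
    ultimately show ?thesis using q P.subset by (simp add: subset_iff)
  qed
  then show ?thesis by (rule distinguishingI[OF P.one_closed])
qed

text \<open>P acts freely on its distinguishing colourings: if translating c by x and by y gives the
  same colouring, then x times the inverse of y preserves c, so x = y. Each orbit thus has |P|
  elements.\<close>

lemma inj_on_distinguishing_compose: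
  assumes P: "subgroup P (BijGroup I)" and c: "distinguishing I P c"
  shows "inj_on (\<lambda>q. \<lambda>i \<in> I. c (q i)) P"
proof (rule inj_onI)
  interpret B: group "BijGroup I" by (rule group_BijGroup)
  interpret P: subgroup P "BijGroup I" by fact
  fix x y assume x: "x \<in> P" and y: "y \<in> P"
    and eq: "(\<lambda>i \<in> I. c (x i)) = (\<lambda>i \<in> I. c (y i))"
  have B: "x \<in> Bij I" "y \<in> Bij I" using x y P.subset by (auto simp: BijGroup_def)
  have iy: "inv\<^bsub>BijGroup I\<^esub> y \<in> P" using y by simp
  then have iyB: "inv\<^bsub>BijGroup I\<^esub> y \<in> Bij I" using P.subset by (auto simp: BijGroup_def)
  let ?r = "x \<otimes>\<^bsub>BijGroup I\<^esub> inv\<^bsub>BijGroup I\<^esub> y"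
  have "c (?r i) = c i" if i: "i \<in> I" for i
  proof -
    let ?j = "(inv\<^bsub>BijGroup I\<^esub> y) i"
    have j: "?j \<in> I" using iyB i Bij_imp_funcset by blast
    have "(y \<otimes>\<^bsub>BijGroup I\<^esub> inv\<^bsub>BijGroup I\<^esub> y) i = i"
      using y P.subset i by (simp add: subset_iff) (simp add: BijGroup_def)
    then have "y ?j = i" using B iyB i by (simp add: BijGroup_def[of I] compose_eq)
    moreover have "?r i = x ?j" using B iyB i by (simp add: BijGroup_def[of I] compose_eq)
    moreover have "c (x ?j) = c (y ?j)" using fun_cong[OF eq, of ?j] j by simp
    ultimately show ?thesis by simp
  qed
  then have "?r = \<one>\<^bsub>BijGroup I\<^esub>" using distinguishingD[OF c] x iy by simp
  then have "inv\<^bsub>BijGroup I\<^esub> (inv\<^bsub>BijGroup I\<^esub> y) = x"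
    using x iy P.subset by (intro B.inv_equality) auto
  then show "x = y" using y P.subset by auto
qed

section \<open>Counting distinguishing colourings with a given palette\<close>

text \<open>R is a palette whose colours need not all occur. Extensionality outside I makes each
  colouring a single function, as \<open>card\<close> requires.\<close>

definition distinguishing_colourings :: "'i set \<Rightarrow> ('i \<Rightarrow> 'i) set \<Rightarrow> 'c set \<Rightarrow> ('i \<Rightarrow> 'c) set" where
  "distinguishing_colourings I P R = {c \<in> I \<rightarrow>\<^sub>E R. distinguishing I P c}"

lemma finite_distinguishing_colourings:
  assumes "finite I" "finite R"
  shows "finite (distinguishing_colourings I P R)"
proof (rule finite_subset)
  show "distinguishing_colourings I P R \<subseteq> I \<rightarrow>\<^sub>E R" by (auto simp: distinguishing_colourings_def)
  show "finite (I \<rightarrow>\<^sub>E R)" using assms by (intro finite_PiE) auto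
qed

lemma distinguishing_colourings_empty:
  assumes "P \<subseteq> Bij I" "finite R" "card R < distinguishing_number I P"
  shows "distinguishing_colourings I P R = {}"
proof -
  have False if "c \<in> I \<rightarrow>\<^sub>E R" "distinguishing I P c" for c
  proof -
    have "card (c ` I) \<le> card R" using that assms by (intro card_mono) auto
    with distinguishing_number_le[OF assms(1) that(2)] assms(3) show False by simp
  qed
  then show ?thesis by (auto simp: distinguishing_colourings_def)
qed

text \<open>A distinguishing partition with the least number of parts has as many parts as A has
  elements, so its parts can be named by A.\<close>

lemma ex_distinguishing_colouring:
  assumes P: "P \<subseteq> Bij I" "\<one>\<^bsub>BijGroup I\<^esub> \<in> P" and I: "finite I"
    and A: "finite A" "card A = distinguishing_number I P"
  obtains c where "c \<in> I \<rightarrow>\<^sub>E A" "distinguishing I P c" "c ` I = A"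
proof -
  obtain \<pi> where \<pi>: "distinguishing_partition I P \<pi>" "card \<pi> = distinguishing_number I P"
    using distinguishing_number_exists P by blast
  then have part: "partition_on I \<pi>" by (simp add: distinguishing_partition_def)
  then have "finite \<pi>" using I finite_elements by blast
  then obtain f where f: "bij_betw f \<pi> A" using \<pi> A by (metis finite_same_card_bij)
  then obtain c where "c \<in> I \<rightarrow>\<^sub>E A" "colour_classes I c = \<pi>" "c ` I = A"
    using obtain_colouring[OF part, of f] by (auto simp: bij_betw_def)
  then show ?thesis using that \<pi> distinguishing_partition_colour_classes P by blast
qed

text \<open>Take a palette A of D(P) colours from R. The translates under P of one colouring c onto
  A are already |P| distinct colourings, all with values in A. A colouring d onto a second palette B
  of the same size is not among them, since B has a colour outside A.\<close>

lemma card_distinguishing_colourings_gt: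
  assumes P: "subgroup P (BijGroup I)" and I: "finite I" "I \<noteq> {}"
    and R: "finite R" "card R > distinguishing_number I P"
  shows "card (distinguishing_colourings I P R) > card P"
proof -
  let ?D = "distinguishing_number I P"
  have PB: "P \<subseteq> Bij I" and one: "\<one>\<^bsub>BijGroup I\<^esub> \<in> P"
    using subgroup.subset[OF P] subgroup.one_closed[OF P] by (auto simp: BijGroup_def)
  obtain A where A: "A \<subseteq> R" "card A = ?D" "finite A"
    using R by (metis obtain_subset_with_card_n less_imp_le)
  have "?D > 0" using distinguishing_number_pos PB one I by blast
  then obtain a where a: "a \<in> A" using A by fastforce
  obtain b where b: "b \<in> R" "b \<notin> A" using R A by (metis less_irrefl subset_antisym subsetI)
  \<comment> \<open>Exchanging a for b keeps the size D(P) and makes b a colour of d that no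
    translate of c can take.\<close>
  define B where "B = insert b (A - {a})"
  have B: "B \<subseteq> R" "finite B" "card B = ?D"
    using A a b \<open>?D > 0\<close> by (auto simp: B_def card_Diff_singleton)
  obtain c where c: "c \<in> I \<rightarrow>\<^sub>E A" "distinguishing I P c" "c ` I = A"
    using ex_distinguishing_colouring[OF PB one I(1) A(3,2)] by blast
  obtain d where d: "d \<in> I \<rightarrow>\<^sub>E B" "distinguishing I P d" "d ` I = B"
    using ex_distinguishing_colouring[OF PB one I(1) B(2,3)] by blast
  let ?F = "(\<lambda>q. \<lambda>i \<in> I. c (q i)) ` P"
  have memI: "x i \<in> I" if "x \<in> P" "i \<in> I" for x i
    using that PB Bij_imp_funcset by fastforce
  have cA: "c i \<in> A" if "i \<in> I" for i using c that by auto
  have restr: "distinguishing I P (\<lambda>i \<in> I. e i) \<longleftrightarrow> distinguishing I P e" for e :: "'a \<Rightarrow> 'b"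
    by (rule distinguishing_cong[OF PB]) simp
  have "?F \<subseteq> distinguishing_colourings I P R"
    using distinguishing_compose[OF P c(2)] memI cA A(1)
    by (auto simp: distinguishing_colourings_def restr)
  moreover have "d \<in> distinguishing_colourings I P R"
    using d B(1) by (auto simp: distinguishing_colourings_def)
  moreover have "d \<notin> ?F"
  proof
    assume "d \<in> ?F"
    then obtain q where "q \<in> P" "d = (\<lambda>i \<in> I. c (q i))" by blast
    then have "d ` I \<subseteq> A" using memI cA by auto
    then show False using d b by (simp add: B_def)
  qed
  moreover have "card ?F = card P"
    using inj_on_distinguishing_compose[OF P c(2)] by (rule card_image)
  moreover have "finite (distinguishing_colourings I P R)"
    using finite_distinguishing_colourings I R by blast
  ultimately have "card ?F < card (distinguishing_colourings I P R)"
    by (intro psubset_card_mono) auto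
  with \<open>card ?F = card P\<close> show ?thesis by simp
qed

text \<open>The symmetric group of R acts regularly on these colourings by renaming colours.
  Distinct permutations give distinct colourings because c is onto R, and any two colourings onto R
  with the same classes differ by a renaming.\<close>

lemma card_colourings_with_classes:
  assumes c: "c \<in> I \<rightarrow>\<^sub>E R" "c ` I = R" and R: "finite R"
  shows "card {d \<in> I \<rightarrow>\<^sub>E R. d ` I = R \<and> colour_classes I d = colour_classes I c} = fact (card R)"
proof -
  let ?F = "\<lambda>\<sigma>. \<lambda>i \<in> I. \<sigma> (c i)"
  have "bij_betw ?F {\<sigma>. \<sigma> permutes R}
    {d \<in> I \<rightarrow>\<^sub>E R. d ` I = R \<and> colour_classes I d = colour_classes I c}" (is "bij_betw _ _ ?X")
  proof (rule bij_betw_imageI)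
    show "inj_on ?F {\<sigma>. \<sigma> permutes R}"
    proof (rule inj_onI)
      fix s t assume "s \<in> {\<sigma>. \<sigma> permutes R}" "t \<in> {\<sigma>. \<sigma> permutes R}" and eq: "?F s = ?F t"
      then have st: "s permutes R" "t permutes R" by auto
      show "s = t"
      proof
        fix x show "s x = t x"
        proof (cases "x \<in> R")
          case True
          then obtain i where "i \<in> I" "x = c i" using c(2) by blast
          then show ?thesis using fun_cong[OF eq, of i] by simp
        next
          case False
          then show ?thesis using st by (simp add: permutes_not_in)
        qed
      qed
    qed
    show "?F ` {\<sigma>. \<sigma> permutes R} = ?X"
    proof (intro equalityI subsetI)
      fix d assume "d \<in> ?F ` {\<sigma>. \<sigma> permutes R}"
      then obtain s where s: "s permutes R" and d: "d = ?F s" by blast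
      have "d ` I = s ` c ` I" by (auto simp: d)
      also have "\<dots> = R" using c(2) permutes_image[OF s] by simp
      finally have "d ` I = R" .
      moreover have "d \<in> I \<rightarrow>\<^sub>E R" using \<open>d ` I = R\<close> by (auto simp: d)
      moreover have "colour_classes I d = colour_classes I c"
        using permutes_inj[OF s] by (simp add: colour_classes_eq_iff d inj_eq)
      ultimately show "d \<in> ?X" by blast
    next
      fix d assume d: "d \<in> ?X"
      then have dc: "d i = d j \<longleftrightarrow> c i = c j" if "i \<in> I" "j \<in> I" for i j
        using that by (simp add: colour_classes_eq_iff)
      have inv: "inv_into I c x \<in> I" "c (inv_into I c x) = x" if "x \<in> R" for x
        using that c(2) by (auto simp: inv_into_into f_inv_into_f)
      \<comment> \<open>The renaming that takes c to d: a colour x goes to the colour that d has at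
        some point which c colours x. By \<open>dc\<close> the choice of that point is immaterial.
        Outside R it is the identity, as \<open>permutes\<close> demands.\<close>
      define s where "s x = (if x \<in> R then d (inv_into I c x) else x)" for x
      have sc: "s (c i) = d i" if "i \<in> I" for i
      proof -
        have "c i \<in> R" using that c by auto
        then show ?thesis using that inv dc by (simp add: s_def)
      qed
      have "s ` R = d ` I" using sc c(2) by (metis (no_types, lifting) image_cong image_image)
      then have "s ` R = R" using d by simp
      \<comment> \<open>As R is finite, a map of R onto itself is injective.\<close>
      then have "bij_betw s R R" using R eq_card_imp_inj_on[of R s] by (simp add: bij_betw_def)
      then have "s permutes R" by (intro bij_imp_permutes) (auto simp: s_def)
      moreover have "d = ?F s"
        using d sc by (auto simp: fun_eq_iff restrict_def PiE_def extensional_def)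
      ultimately show "d \<in> ?F ` {\<sigma>. \<sigma> permutes R}" by blast
    qed
  qed
  then have "card ?X = card {\<sigma>. \<sigma> permutes R}" by (rule bij_betw_same_card[symmetric])
  then show ?thesis using card_permutations[OF refl R] by simp
qed

text \<open>Colourings are sorted by their partition into colour classes. With exactly D(P) colours
  available all of them must occur, so these partitions have \<open>card R\<close> parts, and each
  arises from \<open>fact (card R)\<close> colourings.\<close>

lemma card_distinguishing_colourings_eq:
  assumes P: "P \<subseteq> Bij I" and I: "finite I"
    and R: "finite R" "card R = distinguishing_number I P"
  shows "card (distinguishing_colourings I P R) =
    fact (card R) * num_distinguishing_partitions I P (card R)"
proof -
  let ?\<Pi> = "{\<pi>. distinguishing_partition I P \<pi> \<and> card \<pi> = card R}"
  let ?X = "\<lambda>\<pi>. {d \<in> I \<rightarrow>\<^sub>E R. d ` I = R \<and> colour_classes I d = \<pi>}"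
  have cardX: "card (?X \<pi>) = fact (card R)" if \<pi>: "\<pi> \<in> ?\<Pi>" for \<pi>
  proof -
    have part: "partition_on I \<pi>" using \<pi> by (simp add: distinguishing_partition_def)
    have "finite \<pi>" using part I finite_elements by blast
    then obtain f where f: "bij_betw f \<pi> R"
      using \<pi> R by (metis (mono_tags, lifting) finite_same_card_bij mem_Collect_eq)
    then obtain c where c: "c \<in> I \<rightarrow>\<^sub>E R" "colour_classes I c = \<pi>" "c ` I = R"
      using obtain_colouring[OF part, of f] by (auto simp: bij_betw_def)
    show ?thesis using card_colourings_with_classes[OF c(1,3) R(1)] c(2) by simp
  qed
  have surj: "c ` I = R" if "c \<in> I \<rightarrow>\<^sub>E R" "distinguishing I P c" for c
    using that R distinguishing_number_le[OF P that(2)] by (intro card_seteq) auto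
  have "distinguishing_colourings I P R = (\<Union>\<pi> \<in> ?\<Pi>. ?X \<pi>)"
  proof (intro equalityI subsetI)
    fix c assume "c \<in> distinguishing_colourings I P R"
    then have c: "c \<in> I \<rightarrow>\<^sub>E R" "distinguishing I P c"
      by (auto simp: distinguishing_colourings_def)
    then have "c ` I = R" by (rule surj)
    then have "colour_classes I c \<in> ?\<Pi>"
      using c(2) distinguishing_partition_colour_classes[OF P, of c] card_colour_classes[of I c] by simp
    with c(1) \<open>c ` I = R\<close> show "c \<in> (\<Union>\<pi> \<in> ?\<Pi>. ?X \<pi>)" by blast
  next
    fix c assume "c \<in> (\<Union>\<pi> \<in> ?\<Pi>. ?X \<pi>)"
    then show "c \<in> distinguishing_colourings I P R"
      using distinguishing_partition_colour_classes[OF P, of c]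
      by (auto simp: distinguishing_colourings_def)
  qed
  moreover have "card (\<Union>\<pi> \<in> ?\<Pi>. ?X \<pi>) = (\<Sum>\<pi> \<in> ?\<Pi>. card (?X \<pi>))"
  proof (rule card_UN_disjoint)
    have "?\<Pi> \<subseteq> Pow (Pow I)"
      by (auto simp: distinguishing_partition_def partition_on_def)
    then show "finite ?\<Pi>" using I by (meson finite_Pow_iff finite_subset)
    have "finite (I \<rightarrow>\<^sub>E R)" using I R by (intro finite_PiE) auto
    then show "\<forall>\<pi> \<in> ?\<Pi>. finite (?X \<pi>)" by simp
  qed auto
  moreover have "(\<Sum>\<pi> \<in> ?\<Pi>. card (?X \<pi>)) = fact (card R) * card ?\<Pi>"
    using cardX by simp
  ultimately show ?thesis by (simp add: num_distinguishing_partitions_def)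
qed

section \<open>Stabilisers in the product action\<close>

lemma group_action_perm_group:
  assumes "subgroup H (BijGroup \<Gamma>)"
  shows "group_action (perm_group \<Gamma> H) \<Gamma> (\<lambda>g. g)"
proof (intro group_action.intro group_hom.intro group_hom_axioms.intro)
  show "group (BijGroup \<Gamma>)" by (rule group_BijGroup)
  then show "group (perm_group \<Gamma> H)" using group.subgroup_imp_group assms by blast
  show "(\<lambda>g. g) \<in> hom (perm_group \<Gamma> H) (BijGroup \<Gamma>)"
    using subgroup.subset[OF assms] by (auto simp: hom_def)
qed

text \<open>Replacing the coordinate i by p i removes the inverse of p from the product
  action.\<close>

lemma product_action_fixes_iff:
  assumes p: "p \<in> Bij I" and w: "w \<in> I \<rightarrow>\<^sub>E \<Gamma>"
  shows "product_action \<Gamma> I (a, p) w = w \<longleftrightarrow> (\<forall>i \<in> I. a (p i) (w i) = w (p i))"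
proof -
  have bij: "bij_betw p I I" using p by (simp add: Bij_def)
  then have img: "p ` I = I" by (simp add: bij_betw_def)
  have "product_action \<Gamma> I (a, p) w = w \<longleftrightarrow> (\<forall>i \<in> I. a i (w (inv_into I p i)) = w i)"
    using w by (auto simp: product_action_def fun_eq_iff restrict_def PiE_def extensional_def)
  also have "\<dots> \<longleftrightarrow> (\<forall>i \<in> p ` I. a i (w (inv_into I p i)) = w i)" by (simp add: img)
  also have "\<dots> \<longleftrightarrow> (\<forall>i \<in> I. a (p i) (w i) = w (p i))"
    using bij by (auto simp: bij_betw_inv_into_left)
  finally show ?thesis .
qed

text \<open>An element (a, p) fixes w iff each a (p i) takes w i to w (p i). If only the identity
  does so, elements acting on a single coordinate show that each w i has trivial stabiliser, and a p
  that preserves the H-orbits of the entries must be trivial because it lifts to some (a, p) fixing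
  w. Conversely, the p of an element fixing w preserves these orbits, so p is trivial, and then each
  a i fixes w i.\<close>

lemma stabilizer_wreath_trivial_iff:
  fixes H :: "('a \<Rightarrow> 'a) set" and P :: "('i \<Rightarrow> 'i) set" and \<Gamma> I
  defines "W \<equiv> wreath_product (perm_group \<Gamma> H) I P"
  assumes H: "subgroup H (BijGroup \<Gamma>)" and P: "subgroup P (BijGroup I)" and w: "w \<in> I \<rightarrow>\<^sub>E \<Gamma>"
  shows "stabilizer W (product_action \<Gamma> I) w = {\<one>\<^bsub>W\<^esub>} \<longleftrightarrow>
    (\<forall>i \<in> I. stabilizer (perm_group \<Gamma> H) (\<lambda>g. g) (w i) = {\<one>\<^bsub>perm_group \<Gamma> H\<^esub>}) \<and>
    distinguishing I P (\<lambda>i. orbit (perm_group \<Gamma> H) (\<lambda>g. g) (w i))"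
proof -
  let ?H = "perm_group \<Gamma> H"
  let ?o = "\<lambda>x. orbit ?H (\<lambda>g. g) x"
  let ?e = "\<one>\<^bsub>BijGroup \<Gamma>\<^esub>"
  interpret H: group_action ?H \<Gamma> "\<lambda>g. g" using group_action_perm_group H .
  interpret W: group_action W "I \<rightarrow>\<^sub>E \<Gamma>" "product_action \<Gamma> I"
    unfolding W_def using group_action_product_action H P .
  have PB: "p \<in> Bij I" if "p \<in> P" for p
    using subgroup.subset[OF P] that by (auto simp: BijGroup_def)
  have memI: "p i \<in> I" if "p \<in> P" "i \<in> I" for p i
    using Bij_imp_funcset[OF PB[OF that(1)]] that(2) by blast
  have wG: "w i \<in> \<Gamma>" if "i \<in> I" for i using w that by blast
  have H1: "?e \<in> H" and P1: "\<one>\<^bsub>BijGroup I\<^esub> \<in> P"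
    using subgroup.one_closed H P by auto
  have one: "?e x = x" if "x \<in> \<Gamma>" for x using that by (simp add: BijGroup_def)
  have oneI: "\<one>\<^bsub>BijGroup I\<^esub> i = i" if "i \<in> I" for i using that by (simp add: BijGroup_def)
  have W1: "\<one>\<^bsub>W\<^esub> = (\<lambda>i \<in> I. ?e, \<one>\<^bsub>BijGroup I\<^esub>)" by (simp add: W_def wreath_product_def)
  have stab: "(a, p) \<in> stabilizer W (product_action \<Gamma> I) w \<longleftrightarrow>
    a \<in> I \<rightarrow>\<^sub>E H \<and> p \<in> P \<and> (\<forall>i \<in> I. a (p i) (w i) = w (p i))" for a p
    using product_action_fixes_iff[OF PB w, of p a]
    by (auto simp: stabilizer_def W_def wreath_product_def)
  have stabH: "h \<in> stabilizer ?H (\<lambda>g. g) x \<longleftrightarrow> h \<in> H \<and> h x = x" for h x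
    by (auto simp: stabilizer_def)
  have orb: "?o x = ?o y \<longleftrightarrow> (\<exists>h \<in> H. h x = y)" if "x \<in> \<Gamma>" "y \<in> \<Gamma>" for x y
  proof
    assume "?o x = ?o y"
    then have "y \<in> ?o x" using H.orbit_refl that by blast
    then show "\<exists>h \<in> H. h x = y" by (auto simp: orbit_def)
  next
    assume "\<exists>h \<in> H. h x = y"
    then have "y \<in> ?o x" by (auto simp: orbit_def)
    then show "?o x = ?o y" using H.orbit_eqI that by blast
  qed
  show ?thesis
  proof (intro iffI conjI ballI)
    assume tr: "stabilizer W (product_action \<Gamma> I) w = {\<one>\<^bsub>W\<^esub>}"
    fix k assume k: "k \<in> I"
    have "h = ?e" if h: "h \<in> H" "h (w k) = w k" for h
    proof -
      \<comment> \<open>The element of the base group that acts by h on coordinate k alone.\<close>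
      let ?a = "\<lambda>i \<in> I. if i = k then h else ?e"
      have "(?a, \<one>\<^bsub>BijGroup I\<^esub>) \<in> stabilizer W (product_action \<Gamma> I) w"
        unfolding stab using h H1 P1 one wG by (auto simp: oneI)
      then have "?a = (\<lambda>i \<in> I. ?e)" using tr W1 by simp
      from fun_cong[OF this, of k] show ?thesis using k by simp
    qed
    moreover have "?e \<in> stabilizer ?H (\<lambda>g. g) (w k)" using H1 one[OF wG[OF k]] stabH by blast
    ultimately have "stabilizer ?H (\<lambda>g. g) (w k) = {?e}" using stabH by blast
    then show "stabilizer ?H (\<lambda>g. g) (w k) = {\<one>\<^bsub>?H\<^esub>}" by simp
  next
    assume tr: "stabilizer W (product_action \<Gamma> I) w = {\<one>\<^bsub>W\<^esub>}"
    have "p = \<one>\<^bsub>BijGroup I\<^esub>" if p: "p \<in> P" "\<forall>i \<in> I. ?o (w (p i)) = ?o (w i)" for p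
    proof -
      have img: "p ` I = I" using PB[OF p(1)] by (simp add: Bij_def bij_betw_def)
      have inv: "inv_into I p j \<in> I" "p (inv_into I p j) = j" if "j \<in> I" for j
        using that img by (auto simp: inv_into_into f_inv_into_f)
      \<comment> \<open>The lift of p: coordinate j receives the entry at the preimage of j under p,
        which lies in the H-orbit of w j and so can be moved to w j by H.\<close>
      have "\<forall>j \<in> I. \<exists>h \<in> H. h (w (inv_into I p j)) = w j"
        using p(2) inv orb wG by metis
      then obtain a where a: "\<And>j. j \<in> I \<Longrightarrow> a j \<in> H \<and> a j (w (inv_into I p j)) = w j"
        by metis
      have "inv_into I p (p i) = i" if "i \<in> I" for i
        using that PB[OF p(1)] by (intro inv_into_f_f) (auto simp: Bij_def bij_betw_def)
      then have "(restrict a I, p) \<in> stabilizer W (product_action \<Gamma> I) w"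
        unfolding stab using a p(1) memI by auto (metis memI)
      then show ?thesis using tr W1 by simp
    qed
    then show "distinguishing I P (\<lambda>i. ?o (w i))" by (rule distinguishingI[OF P1])
  next
    assume "(\<forall>i \<in> I. stabilizer ?H (\<lambda>g. g) (w i) = {\<one>\<^bsub>?H\<^esub>}) \<and>
      distinguishing I P (\<lambda>i. ?o (w i))"
    then have st: "\<And>i. i \<in> I \<Longrightarrow> stabilizer ?H (\<lambda>g. g) (w i) = {?e}"
      and dist: "distinguishing I P (\<lambda>i. ?o (w i))" by auto
    have "x = \<one>\<^bsub>W\<^esub>" if x: "x \<in> stabilizer W (product_action \<Gamma> I) w" for x
    proof -
      obtain a p where xe: "x = (a, p)" by (cases x)
      then have ap: "a \<in> I \<rightarrow>\<^sub>E H" "p \<in> P" "\<And>i. i \<in> I \<Longrightarrow> a (p i) (w i) = w (p i)"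
        using x stab by auto
      have aH: "a i \<in> H" if "i \<in> I" for i using ap(1) that by blast
      \<comment> \<open>The element a (p i) of H takes w i to w (p i), so both lie in one
        orbit.\<close>
      have "\<forall>i \<in> I. ?o (w (p i)) = ?o (w i)"
        using ap aH memI orb wG by metis
      then have p1: "p = \<one>\<^bsub>BijGroup I\<^esub>" by (rule distinguishingD[OF dist ap(2)])
      have "a i = ?e" if i: "i \<in> I" for i
      proof -
        have "a i (w i) = w i" using ap(3)[OF i] i by (simp add: p1 oneI)
        then have "a i \<in> stabilizer ?H (\<lambda>g. g) (w i)" using aH[OF i] stabH by blast
        then show ?thesis using st[OF i] by simp
      qed
      then have "a = (\<lambda>i \<in> I. ?e)" using ap(1) by (auto simp: fun_eq_iff PiE_def extensional_def)
      then show ?thesis using p1 xe W1 by simp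
    qed
    then show "stabilizer W (product_action \<Gamma> I) w = {\<one>\<^bsub>W\<^esub>}"
      using W.stabilizer_one_closed[OF w] by blast
  qed
qed

text \<open>Double counting of the tuples with trivial stabiliser. Each regular orbit of the wreath
  product contains |H|^|I| |P| of them, and each distinguishing colouring by regular H-orbits
  accounts for |H|^|I| of them. The common factor |H|^|I| cancels.\<close>

lemma card_regular_orbits_wreath:
  assumes H: "subgroup H (BijGroup \<Gamma>)" and P: "subgroup P (BijGroup I)"
    and fin: "finite \<Gamma>" "finite I"
  shows "card (regular_orbits (wreath_product (perm_group \<Gamma> H) I P)
      (I \<rightarrow>\<^sub>E \<Gamma>) (product_action \<Gamma> I)) * card P =
    card (distinguishing_colourings I P (regular_orbits (perm_group \<Gamma> H) \<Gamma> (\<lambda>g. g)))"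
proof -
  let ?H = "perm_group \<Gamma> H"
  let ?W = "wreath_product ?H I P"
  let ?R = "regular_orbits ?H \<Gamma> (\<lambda>g. g)"
  let ?C = "distinguishing_colourings I P ?R"
  let ?o = "\<lambda>x. orbit ?H (\<lambda>g. g) x"
  let ?E = "I \<rightarrow>\<^sub>E \<Gamma>"
  interpret H: group_action ?H \<Gamma> "\<lambda>g. g" using group_action_perm_group H .
  interpret W: group_action ?W ?E "product_action \<Gamma> I"
    using group_action_product_action H P .
  have finR: "finite ?R" using H.finite_regular_orbits fin by blast
  have PB: "P \<subseteq> Bij I" using subgroup.subset[OF P] by (simp add: BijGroup_def)
  \<comment> \<open>The colours are themselves sets, namely regular orbits of H, so
    \<open>PiE I c\<close> is the box of all tuples whose entry at i lies in the orbit c i.\<close>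
  have un: "{w \<in> ?E. stabilizer ?W (product_action \<Gamma> I) w = {\<one>\<^bsub>?W\<^esub>}} = (\<Union>c \<in> ?C. PiE I c)"
  proof (intro equalityI subsetI)
    fix w assume "w \<in> {w \<in> ?E. stabilizer ?W (product_action \<Gamma> I) w = {\<one>\<^bsub>?W\<^esub>}}"
    then have w: "w \<in> ?E" and st: "\<And>i. i \<in> I \<Longrightarrow> stabilizer ?H (\<lambda>g. g) (w i) = {\<one>\<^bsub>?H\<^esub>}"
      and dist: "distinguishing I P (\<lambda>i. ?o (w i))"
      using stabilizer_wreath_trivial_iff[OF H P] by auto
    have wG: "w i \<in> \<Gamma>" if "i \<in> I" for i using w that by blast
    let ?c = "\<lambda>i \<in> I. ?o (w i)"
    have "distinguishing I P ?c" using dist distinguishing_cong[OF PB, of ?c "\<lambda>i. ?o (w i)"] by simp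
    moreover have "?o (w i) \<in> ?R" if "i \<in> I" for i
      using H.orbit_in_regular_orbits wG st that by blast
    ultimately have "?c \<in> ?C" by (simp add: distinguishing_colourings_def)
    moreover have "w \<in> PiE I ?c" using w H.orbit_refl[OF wG] by (auto simp: PiE_def)
    ultimately show "w \<in> (\<Union>c \<in> ?C. PiE I c)" by blast
  next
    fix w assume "w \<in> (\<Union>c \<in> ?C. PiE I c)"
    then obtain c where cR: "c \<in> I \<rightarrow>\<^sub>E ?R" and dist: "distinguishing I P c" and w: "w \<in> PiE I c"
      by (auto simp: distinguishing_colourings_def)
    have wc: "w i \<in> \<Gamma>" "?o (w i) = c i" "stabilizer ?H (\<lambda>g. g) (w i) = {\<one>\<^bsub>?H\<^esub>}"
      if i: "i \<in> I" for i
    proof -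
      have "c i \<in> ?R" "w i \<in> c i" using i cR w by blast+
      from H.regular_orbitD[OF this] show "w i \<in> \<Gamma>" "?o (w i) = c i"
        "stabilizer ?H (\<lambda>g. g) (w i) = {\<one>\<^bsub>?H\<^esub>}" .
    qed
    have wE: "w \<in> ?E" using w wc(1) by (auto simp: PiE_def)
    moreover have "distinguishing I P (\<lambda>i. ?o (w i))"
      using dist distinguishing_cong[OF PB, of c "\<lambda>i. ?o (w i)"] wc(2) by simp
    ultimately show "w \<in> {w \<in> ?E. stabilizer ?W (product_action \<Gamma> I) w = {\<one>\<^bsub>?W\<^esub>}}"
      using stabilizer_wreath_trivial_iff[OF H P wE] wc(3) by blast
  qed
  have "card (\<Union>c \<in> ?C. PiE I c) = (\<Sum>c \<in> ?C. card (PiE I c))"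
  proof (rule card_UN_disjoint)
    show "finite ?C"
      using finite_distinguishing_colourings fin finR by blast
    have "PiE I c \<subseteq> ?E" if "c \<in> ?C" for c
      using that H.regular_orbitD(1) by (intro PiE_mono) (auto simp: distinguishing_colourings_def)
    then show "\<forall>c \<in> ?C. finite (PiE I c)"
      using fin by (meson finite_PiE finite_subset)
    show "\<forall>c \<in> ?C. \<forall>d \<in> ?C. c \<noteq> d \<longrightarrow> PiE I c \<inter> PiE I d = {}"
    proof (intro ballI impI)
      fix c d assume cd: "c \<in> ?C" "d \<in> ?C" "c \<noteq> d"
      then have E: "c \<in> I \<rightarrow>\<^sub>E ?R" "d \<in> I \<rightarrow>\<^sub>E ?R" by (auto simp: distinguishing_colourings_def)
      with cd(3) obtain i where i: "i \<in> I" "c i \<noteq> d i" by (meson PiE_ext)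
      then have "c i \<in> ?R" "d i \<in> ?R" using E by blast+
      \<comment> \<open>Distinct orbits are disjoint, so boxes of different colourings are separated
        by a single coordinate.\<close>
      then have "c i \<inter> d i = {}" using i(2) H.regular_orbitD(2) by blast
      then show "PiE I c \<inter> PiE I d = {}" using i(1) by blast
    qed
  qed
  moreover have "card (PiE I c) = card H ^ card I" if "c \<in> ?C" for c
  proof -
    have "card (c i) = card H" if "i \<in> I" for i
      using H.card_regular_orbit[of "c i"] that \<open>c \<in> ?C\<close>
      by (auto simp: distinguishing_colourings_def order_def)
    then show ?thesis using fin by (simp add: card_PiE)
  qed
  ultimately have "card (\<Union>c \<in> ?C. PiE I c) = card H ^ card I * card ?C" by simp
  moreover have "order ?W = card H ^ card I * card P"
    using fin by (simp add: order_def wreath_product_def card_cartesian_product card_funcsetE)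
  \<comment> \<open>Needed to cancel the power of |H|; an infinite H would have \<open>card\<close>
    equal to 0.\<close>
  moreover have "card H > 0"
  proof -
    have "finite (Bij \<Gamma>)"
    proof (rule finite_subset)
      show "Bij \<Gamma> \<subseteq> \<Gamma> \<rightarrow>\<^sub>E \<Gamma>" using Bij_imp_funcset by (auto simp: Bij_def PiE_def)
      show "finite (\<Gamma> \<rightarrow>\<^sub>E \<Gamma>)" using fin by (simp add: finite_PiE)
    qed
    then have "finite H" using subgroup.subset[OF H] finite_subset by (auto simp: BijGroup_def)
    then show ?thesis using subgroup.one_closed[OF H] by (auto simp: card_gt_0_iff)
  qed
  moreover have "card (\<Union>c \<in> ?C. PiE I c) =
      order ?W * card (regular_orbits ?W ?E (product_action \<Gamma> I))"
    using W.card_trivial_stabilizer fin unfolding un by (simp add: finite_PiE)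
  ultimately show ?thesis by (simp add: mult.commute)
qed

section \<open>Point stabilisers and suborbits of the wreath product\<close>

text \<open>Permuting coordinates fixes a constant tuple, so (a, p) fixes it iff every a i fixes x.
  With this base point the stabiliser is again a wreath product with the same P.\<close>

lemma stabilizer_wreath_constant:
  assumes L: "subgroup L (BijGroup \<Gamma>)" and P: "subgroup P (BijGroup I)" and x: "x \<in> \<Gamma>"
  defines "W \<equiv> wreath_product (perm_group \<Gamma> L) I P"
  shows "W\<lparr>carrier := stabilizer W (product_action \<Gamma> I) (\<lambda>i \<in> I. x)\<rparr> =
    wreath_product (perm_group \<Gamma> (stabilizer (perm_group \<Gamma> L) (\<lambda>g. g) x)) I P"
proof -
  have PB: "p \<in> Bij I" if "p \<in> P" for p
    using subgroup.subset[OF P] that by (auto simp: BijGroup_def)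
  have fix_iff: "product_action \<Gamma> I (a, p) (\<lambda>i \<in> I. x) = (\<lambda>i \<in> I. x) \<longleftrightarrow> (\<forall>i \<in> I. a i x = x)"
    if p: "p \<in> P" for a p
  proof -
    have img: "p ` I = I" using PB[OF p] by (simp add: Bij_def bij_betw_def)
    have memI: "p i \<in> I" if "i \<in> I" for i using img that by blast
    have "product_action \<Gamma> I (a, p) (\<lambda>i \<in> I. x) = (\<lambda>i \<in> I. x) \<longleftrightarrow> (\<forall>i \<in> I. a (p i) x = x)"
      using product_action_fixes_iff[OF PB[OF p], of "\<lambda>i \<in> I. x" \<Gamma> a] x memI by auto
    also have "\<dots> \<longleftrightarrow> (\<forall>i \<in> p ` I. a i x = x)" by simp
    finally show ?thesis by (simp add: img)
  qed
  have "stabilizer W (product_action \<Gamma> I) (\<lambda>i \<in> I. x) =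
      (I \<rightarrow>\<^sub>E stabilizer (perm_group \<Gamma> L) (\<lambda>g. g) x) \<times> P"
    using fix_iff by (auto simp: stabilizer_def W_def wreath_product_def)
  \<comment> \<open>Equality of records, not merely isomorphism: multiplication and unit come from
    the symmetric groups and do not depend on the carriers.\<close>
  then show ?thesis by (simp add: W_def wreath_product_def)
qed

text \<open>The base group is already transitive, since L can move each coordinate
  independently.\<close>

lemma transitive_product_action:
  assumes L: "subgroup L (BijGroup \<Gamma>)" and P: "subgroup P (BijGroup I)"
    and tr: "transitive_action (perm_group \<Gamma> L) \<Gamma> (\<lambda>g. g)"
  shows "transitive_action (wreath_product (perm_group \<Gamma> L) I P) (I \<rightarrow>\<^sub>E \<Gamma>) (product_action \<Gamma> I)"
proof (intro transitive_action.intro transitive_action_axioms.intro)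
  show "group_action (wreath_product (perm_group \<Gamma> L) I P) (I \<rightarrow>\<^sub>E \<Gamma>) (product_action \<Gamma> I)"
    using group_action_product_action L P .
next
  fix v w assume v: "v \<in> I \<rightarrow>\<^sub>E \<Gamma>" and w: "w \<in> I \<rightarrow>\<^sub>E \<Gamma>"
  have "\<exists>g \<in> L. g (v i) = w i" if "i \<in> I" for i
    using transitive_action.unique_orbit[OF tr, of "v i" "w i"] v w that by auto
  then obtain a where a: "\<And>i. i \<in> I \<Longrightarrow> a i \<in> L \<and> a i (v i) = w i" by metis
  have one: "inv_into I \<one>\<^bsub>BijGroup I\<^esub> i = i" if "i \<in> I" for i
    using that by (intro inv_into_f_eq) (auto simp: BijGroup_def inj_on_def)
  let ?g = "(restrict a I, \<one>\<^bsub>BijGroup I\<^esub>)"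
  have "?g \<in> carrier (wreath_product (perm_group \<Gamma> L) I P)"
    using a subgroup.one_closed[OF P] by (auto simp: wreath_product_def)
  moreover have "product_action \<Gamma> I ?g v = w"
    using v w a by (auto simp: product_action_def one fun_eq_iff restrict_def PiE_def extensional_def)
  ultimately show "\<exists>g \<in> carrier (wreath_product (perm_group \<Gamma> L) I P). product_action \<Gamma> I g v = w"
    by blast
qed

text \<open>R is the set of regular orbits of a point stabiliser in L. By transitivity the suborbits
  may be counted at x for L and at the constant tuple x for the wreath product. What remains is a
  count of colourings in which only the size of R matters.\<close>

lemma num_regular_suborbits_wreath:
  fixes \<Gamma> :: "'a set"
  assumes L: "subgroup L (BijGroup \<Gamma>)" and P: "subgroup P (BijGroup I)"
    and tr: "transitive_action (perm_group \<Gamma> L) \<Gamma> (\<lambda>g. g)"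
    and fin: "finite \<Gamma>" "finite I" and ne: "\<Gamma> \<noteq> {}"
  obtains R :: "'a set set" where "finite R"
    "num_regular_suborbits (perm_group \<Gamma> L) \<Gamma> (\<lambda>g. g) = card R"
    "num_regular_suborbits (wreath_product (perm_group \<Gamma> L) I P) (I \<rightarrow>\<^sub>E \<Gamma>) (product_action \<Gamma> I)
       * card P = card (distinguishing_colourings I P R)"
proof -
  obtain x where x: "x \<in> \<Gamma>" using ne by blast
  let ?L = "perm_group \<Gamma> L"
  define H where "H = stabilizer ?L (\<lambda>g. g) x"
  interpret L: transitive_action ?L \<Gamma> "\<lambda>g. g" by fact
  have H: "subgroup H (BijGroup \<Gamma>)"
    using group.incl_subgroup[OF group_BijGroup L] L.stabilizer_subgroup[OF x]
    by (simp add: H_def)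
  interpret H: group_action "perm_group \<Gamma> H" \<Gamma> "\<lambda>g. g" using group_action_perm_group H .
  have const: "(\<lambda>i \<in> I. x) \<in> I \<rightarrow>\<^sub>E \<Gamma>" using x by simp
  show ?thesis
  proof
    show "finite (regular_orbits (perm_group \<Gamma> H) \<Gamma> (\<lambda>g. g))"
      using H.finite_regular_orbits fin by blast
    show "num_regular_suborbits ?L \<Gamma> (\<lambda>g. g) = card (regular_orbits (perm_group \<Gamma> H) \<Gamma> (\<lambda>g. g))"
      using num_regular_suborbits_eq[OF tr x] by (simp add: H_def)
    show "num_regular_suborbits (wreath_product ?L I P) (I \<rightarrow>\<^sub>E \<Gamma>) (product_action \<Gamma> I) * card P =
        card (distinguishing_colourings I P (regular_orbits (perm_group \<Gamma> H) \<Gamma> (\<lambda>g. g)))"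
      using card_regular_orbits_wreath[OF H P fin]
        num_regular_suborbits_eq[OF transitive_product_action[OF L P tr] const]
        stabilizer_wreath_constant[OF L P x]
      by (simp add: H_def)
  qed
qed

theorem corollary5:
  fixes \<Gamma> :: "'a set" and L :: "('a \<Rightarrow> 'a) set" and k :: nat and P :: "(nat \<Rightarrow> nat) set"
  assumes "k \<ge> 2"
    and "subgroup P (BijGroup {1..k})"
    and "transitive_action (perm_group {1..k} P) {1..k} (\<lambda>p. p)"
    and "finite \<Gamma>"
    and "subgroup L (BijGroup \<Gamma>)"
    and "primitive_action (perm_group \<Gamma> L) \<Gamma> (\<lambda>g. g)"
    and "almost_simple (perm_group \<Gamma> L) \<or> diagonal_type \<Gamma> L"
  shows "num_regular_suborbits (wreath_product (perm_group \<Gamma> L) {1..k} P)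
             ({1..k} \<rightarrow>\<^sub>E \<Gamma>) (product_action \<Gamma> {1..k}) = 1 \<longleftrightarrow>
         num_regular_suborbits (perm_group \<Gamma> L) \<Gamma> (\<lambda>g. g) = distinguishing_number {1..k} P \<and>
         real (num_distinguishing_partitions {1..k} P (distinguishing_number {1..k} P)) =
           real (card P) / fact (distinguishing_number {1..k} P)"
    (is "?r = 1 \<longleftrightarrow> ?s = ?D \<and> ?t = _")
proof -
  let ?I = "{1..k}"
  note P = assms(2)
  have tr: "transitive_action (perm_group \<Gamma> L) \<Gamma> (\<lambda>g. g)" and ne: "\<Gamma> \<noteq> {}"
    using assms(6) by (auto simp: primitive_action_def)
  have I: "finite ?I" "?I \<noteq> {}" using assms(1) by auto
  have PB: "P \<subseteq> Bij ?I" using subgroup.subset[OF P] by (simp add: BijGroup_def)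
  have "Bij ?I \<subseteq> ?I \<rightarrow>\<^sub>E ?I" using Bij_imp_funcset by (auto simp: Bij_def PiE_def)
  then have "finite P" using PB finite_PiE[OF I(1)] I(1) by (meson finite_subset)
  then have cardP: "card P > 0" using subgroup.one_closed[OF P] by (auto simp: card_gt_0_iff)
  obtain R :: "'a set set" where R: "finite R" "?s = card R"
    "?r * card P = card (distinguishing_colourings ?I P R)"
    using num_regular_suborbits_wreath[OF assms(5) P tr assms(4) I(1) ne] .
  \<comment> \<open>The positive factor |P| cancels from the counting identity.\<close>
  have r1: "?r = 1 \<longleftrightarrow> card (distinguishing_colourings ?I P R) = card P"
    using R(3) cardP by (metis mult_cancel2 mult_1 less_irrefl)
  consider "card R < ?D" | "card R > ?D" | "card R = ?D" by linarith
  then show ?thesis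
  proof cases
    \<comment> \<open>No distinguishing colouring exists, whereas |P| > 0, so both sides of the
      equivalence fail.\<close>
    case 1
    then show ?thesis
      using distinguishing_colourings_empty[OF PB R(1)] r1 R(2) cardP by simp
  next
    \<comment> \<open>There are more than |P| distinguishing colourings, so again both sides
      fail.\<close>
    case 2
    then show ?thesis
      using card_distinguishing_colourings_gt[OF P I R(1)] r1 R(2) by simp
  next
    case 3
    have "?r = 1 \<longleftrightarrow> fact ?D * num_distinguishing_partitions ?I P ?D = card P"
      using r1 card_distinguishing_colourings_eq[OF PB I(1) R(1) 3] 3 by simp
    \<comment> \<open>Passing to the reals lets the factorial be divided out without a divisibility
      condition.\<close>
    also have "\<dots> \<longleftrightarrow> real (fact ?D * num_distinguishing_partitions ?I P ?D) = real (card P)"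
      by (simp only: of_nat_eq_iff)
    also have "\<dots> \<longleftrightarrow> ?t = real (card P) / fact ?D"
      by (simp add: field_simps)
    finally show ?thesis using 3 R(2) by simp
  qed
qed

end
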